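(* Let $P$ be a finite set of points in the plane (in general position with respect to the cone directions). Then the $\theta_5$-graph of $P$ is a spanner with spanning ratio at most $\sqrt{50+22\sqrt{5}} \approx 9.960$; that is, for every two distinct points $u, w \in P$ there is a path between $u$ and $w$ in the $\theta_5$-graph of $P$ whose total Euclidean length is at most $\sqrt{50+22\sqrt{5}}\cdot |uw|$.
   Context: Let $\theta = 2\pi/5$. For a point $u$ in the plane, the five rays from $u$ whose directions make angles that are consecutive multiples of $\theta$ with the negative $y$-axis divide the plane into five cones with apex $u$, labelled $C_0^u, C_1^u, C_2^u, C_3^u, C_4^u$ in clockwise order starting from the top one; thus the bisector of $C_i^u$ is the ray from $u$ whose direction is the positive $y$-direction rotated clockwise by $i\theta$. General position: no two distinct points of $P$ lie on a line parallel or perpendicular to a cone boundary. (Hence each point of $P\setminus\{u\}$ lies in the interior of exactly one cone of $u$, and no two points of $P$ in a cone have the same projection on its bisector.) For a finite point set $P$, the point of $P\setminus\{u\}$ in cone $C_i^u$ that is closest to $u$ is the one whose orthogonal projection onto the bisector of $C_i^u$ is closest to $u$. The $\theta_5$-graph of $P$ is the undirected graph with vertex set $P$ in which, for every $u\in P$ and every $i\in\{0,\dots,4\}$ such that $C_i^u$ contains a point of $P\setminus\{u\}$, there is an edge between $u$ and the closest point to $u$ in $C_i^u$. The weight (length) of an edge is the Euclidean distance between its endpoints; $|uw|$ denotes Euclidean distance; the length of a path is the sum of the lengths of its edges. The spanning ratio of a graph $H$ on $P$ is the smallest $t$ such that for all pairs $u,w\in P$ the shortest path in $H$ between $u$ and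 $w$ has length at most $t\cdot|uw|$; $H$ is a (geometric) spanner if its spanning ratio is bounded by a constant. *)

theory Defs
  imports "HOL-Analysis.Analysis"
begin

text \<open>
  The Euclidean plane is the type \<^typ>\<open>complex\<close>, with its metric \<^const>\<open>dist\<close> and
  inner product \<^const>\<open>inner\<close>; the positive \<open>y\<close>-direction is \<^term>\<open>\<i>\<close>, and
  multiplication by \<^term>\<open>cis (- \<phi>)\<close> is the clockwise rotation by \<open>\<phi>\<close>.
\<close>

definition theta :: real where
  "theta = 2 * pi / 5"

definition ray_dir :: "nat \<Rightarrow> complex" where
  "ray_dir k = - \<i> * cis (- (real k * theta))"

definition bisector_dir :: "nat \<Rightarrow> complex" where
  "bisector_dir i = \<i> * cis (- (real i * theta))"

text \<open>
  The rays are counted clockwise from the negative \<open>y\<close>-direction, so the top cone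
  (number \<open>0\<close>) lies between rays \<open>2\<close> and \<open>3\<close>, at angles \<open>126\<close> and \<open>54\<close> degrees
  with the positive \<open>x\<close>-axis. Cones are closed; points on a boundary do not occur in
  general position.
\<close>

definition theta_cone :: "nat \<Rightarrow> complex \<Rightarrow> complex set" where
  "theta_cone i u =
     {u + a *\<^sub>R ray_dir (i + 2) + b *\<^sub>R ray_dir (i + 3) | a b. 0 \<le> a \<and> 0 \<le> b}"

definition general_position :: "complex set \<Rightarrow> bool" where
  "general_position P \<longleftrightarrow>
     (\<forall>u\<in>P. \<forall>v\<in>P. u \<noteq> v \<longrightarrow>
        (\<forall>k<5. v - u \<notin> span {ray_dir k} \<and> \<not> orthogonal (v - u) (ray_dir k)))"

definition bisector_proj :: "nat \<Rightarrow> complex \<Rightarrow> complex \<Rightarrow> complex" where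
  "bisector_proj i u v = u + ((v - u) \<bullet> bisector_dir i) *\<^sub>R bisector_dir i"

definition closest_in_cone :: "complex set \<Rightarrow> nat \<Rightarrow> complex \<Rightarrow> complex \<Rightarrow> bool" where
  "closest_in_cone P i u w \<longleftrightarrow>
     is_arg_min (\<lambda>v. dist u (bisector_proj i u v)) (\<lambda>v. v \<in> P - {u} \<and> v \<in> theta_cone i u) w"

definition theta5_edges :: "complex set \<Rightarrow> complex set set" where
  "theta5_edges P = {{u, w} | u w. u \<in> P \<and> (\<exists>i<5. closest_in_cone P i u w)}"

definition path_between ::
    "'a set \<Rightarrow> 'a set set \<Rightarrow> 'a \<Rightarrow> 'a list \<Rightarrow> 'a \<Rightarrow> bool" where
  "path_between V E u xs w \<longleftrightarrow>
     xs \<noteq> [] \<and> hd xs = u \<and> last xs = w \<and> distinct xs \<and> set xs \<subseteq> V \<and>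
     successively (\<lambda>x y. {x, y} \<in> E) xs"

definition path_length :: "'a::metric_space list \<Rightarrow> real" where
  "path_length xs = sum_list (map2 dist xs (tl xs))"

text \<open>
  Infima in \<^typ>\<open>ennreal\<close>: the distance of unconnected vertices is \<open>\<infinity>\<close>, and a
  spanning ratio is nonnegative, also when there are fewer than two points.
\<close>

definition graph_dist ::
    "'a::metric_space set \<Rightarrow> 'a set set \<Rightarrow> 'a \<Rightarrow> 'a \<Rightarrow> ennreal" where
  "graph_dist V E u w = (INF xs \<in> {xs. path_between V E u xs w}. ennreal (path_length xs))"

definition spanning_ratio :: "'a::metric_space set \<Rightarrow> 'a set set \<Rightarrow> ennreal" where
  "spanning_ratio V E =
     Inf {t. \<forall>u\<in>V. \<forall>w\<in>V. graph_dist V E u w \<le> t * ennreal (dist u w)}"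

end

theory Submission
  imports Defs
begin

text \<open>
  Let \<open>N z\<close> be the maximum of the projections of \<open>z\<close> onto the five bisectors, the gauge of a regular
  pentagon. A point \<open>w\<close> lies in cone \<open>i\<close> of \<open>u\<close> iff the maximum for \<open>w - u\<close> is attained at \<open>i\<close>, and
  \<open>N (w - u)\<close> measures the canonical triangle of the pair. By induction on \<open>N (w - u)\<close> there is a
  walk from \<open>u\<close> to \<open>w\<close> of length at most a constant times \<open>N (w - u)\<close>. By symmetry let \<open>w\<close>
  lie in cone \<open>0\<close> of \<open>u\<close>, right of the bisector; if \<open>N (u - w) < N (w - u)\<close>, swap the ends.
  Otherwise let \<open>v\<close> be closest to \<open>w\<close> in the cone containing \<open>u\<close>, and \<open>z\<close> closest to \<open>u\<close> in
  cone \<open>0\<close>: one of the three routes through \<open>v\<close>, through \<open>z\<close>, or through \<open>z\<close> and then \<open>v\<close> is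
  short enough. Applying the bound to the smaller of \<open>N (w - u)\<close> and \<open>N (u - w)\<close> gives the theorem.
\<close>

section \<open>Projections onto the bisectors of five cones\<close>

definition golden :: real  (\<open>\<phi>\<close>) where
  "\<phi> = (1 + sqrt 5) / 2"

lemma golden_square: "\<phi> * \<phi> = \<phi> + 1"
  by (simp add: golden_def field_simps)

lemma golden_bounds: "1 < \<phi>" "\<phi> < 2"
proof -
  have "1 < sqrt 5" "sqrt 5 < 3"
    by (simp_all add: real_less_rsqrt real_less_lsqrt)
  then show "1 < \<phi>" "\<phi> < 2"
    by (simp_all add: golden_def)
qed

text \<open>Serves to choose between two routes: if a positive combination of their slacks is
  nonnegative, one of the slacks is.\<close>

lemma weighted_sum_nonneg_cases:
  fixes a b s x y :: real
  assumes "0 \<le> a * (s - x) + b * (s - y)" "0 < a" "0 < b"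
  shows "x \<le> s \<or> y \<le> s"
proof (rule ccontr)
  assume "\<not> ?thesis"
  with assms(2,3) have "a * (s - x) < 0" "b * (s - y) < 0"
    by (simp_all add: mult_less_0_iff)
  with assms(1) show False
    by linarith
qed

text \<open>
  The constant of the induction. It is needed when \<open>w\<close> lies on the boundary of a cone of \<open>u\<close>
  and the edge of \<open>w\<close> towards \<open>u\<close> leads to a far corner of its canonical triangle.
\<close>

definition kappa :: real  (\<open>\<kappa>\<close>) where
  "\<kappa> = 2 * \<phi> ^ 3"

lemma kappa_eq: "\<kappa> = 2 + 4 * \<phi>"
  unfolding kappa_def using golden_square by algebra

text \<open>
  With the projections onto the five bisectors for \<open>q\<close>, this says that \<open>z\<close> lies in cone
  number \<open>i\<close> of the origin (see \<open>theta_cone_iff\<close>).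
\<close>

definition dominant :: "(nat \<Rightarrow> complex \<Rightarrow> real) \<Rightarrow> nat \<Rightarrow> complex \<Rightarrow> bool" where
  "dominant q i z \<longleftrightarrow> (\<forall>j. q j z \<le> q i z)"

lemma dominantD: "dominant q i z \<Longrightarrow> q j z \<le> q i z"
  by (simp add: dominant_def)

text \<open>
  Rotations and reflections of the cones are absorbed by re-indexing the projections, which
  preserves the recurrence (here \<open>\<phi> - 1 = 2 cos 72\<degree>\<close>). Hence it suffices to treat a point in
  cone \<open>0\<close> to the right of the bisector.
\<close>

locale pentagon_frame =
  fixes q :: "nat \<Rightarrow> complex \<Rightarrow> real"
  assumes q_diff: "q i (x - y) = q i x - q i y"
    and q_Suc_Suc: "q (Suc (Suc i)) x = (\<phi> - 1) * q (Suc i) x - q i x"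
begin

lemma q_minus: "q i (- x) = - q i x"
  using q_diff[of i 0 0] q_diff[of i 0 x] by simp

lemma q2: "q 2 x = (\<phi> - 1) * q 1 x - q 0 x"
  using q_Suc_Suc[of 0 x] by (simp add: numeral_eq_Suc)

lemma q3: "q 3 x = (1 - \<phi>) * (q 0 x + q 1 x)"
proof -
  have "q 3 x = (\<phi> - 1) * q 2 x - q 1 x"
    using q_Suc_Suc[of 1 x] by (simp add: numeral_eq_Suc)
  then show ?thesis
    unfolding q2 using golden_square by algebra
qed

lemma q4: "q 4 x = (\<phi> - 1) * q 0 x - q 1 x"
proof -
  have "q 4 x = (\<phi> - 1) * q 3 x - q 2 x"
    using q_Suc_Suc[of 2 x] by (simp add: numeral_eq_Suc)
  then show ?thesis
    unfolding q2 q3 using golden_square by algebra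
qed

text \<open>The projections \<open>q 0\<close> and \<open>q 1\<close> serve as coordinates. After
  this rewriting every identity is polynomial in them and in \<open>\<phi>\<close>, and holds modulo
  \<open>golden_square\<close>.\<close>

lemmas q_expand = q2 q3 q4 q_diff q_minus

text \<open>The characteristic roots of the recurrence have sum 2 cos 72\<degree> and product 1, so
  they are primitive fifth roots of unity.\<close>

lemma q_periodic: "q (i + 5) x = q i x"
proof (induction i rule: induct_nat_012)
  case 0
  have "q 5 x = (\<phi> - 1) * q 4 x - q 3 x"
    using q_Suc_Suc[of 3 x] by (simp add: numeral_eq_Suc)
  then show ?case
    unfolding q3 q4 add_0 using golden_square by algebra
next
  case 1
  have "q 5 x = (\<phi> - 1) * q 4 x - q 3 x" "q 6 x = (\<phi> - 1) * q 5 x - q 4 x"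
    using q_Suc_Suc[of 3 x] q_Suc_Suc[of 4 x] by (simp_all add: numeral_eq_Suc)
  then have "q 6 x = q 1 x"
    unfolding q3 q4 using golden_square by algebra
  then show ?case
    by simp
next
  case (ge2 n)
  then show ?case
    using q_Suc_Suc[of "n + 5" x] q_Suc_Suc[of n x] by simp
qed

lemma q_periodic_mult: "q (i + 5 * n) x = q i x"
proof (induction n)
  case (Suc n)
  then show ?case
    using q_periodic[of "i + 5 * n" x] by (simp add: algebra_simps)
qed simp

lemma q_mod: "q (i mod 5) x = q i x"
  using q_periodic_mult[of "i mod 5" "i div 5" x] by simp

lemma dominantI:
  assumes "q 0 z \<le> q i z" "q 1 z \<le> q i z" "q 2 z \<le> q i z" "q 3 z \<le> q i z" "q 4 z \<le> q i z"
  shows "dominant q i z"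
  unfolding dominant_def
proof
  fix j :: nat
  have "j mod 5 = 0 \<or> j mod 5 = 1 \<or> j mod 5 = 2 \<or> j mod 5 = 3 \<or> j mod 5 = 4"
    by linarith
  then show "q j z \<le> q i z"
    using assms q_mod[of j z] by auto
qed

lemma dominant_exists:
  obtains i where "i \<in> {0, 1, 2, 3, 4}" "dominant q i z"
proof -
  obtain i where "is_arg_min (\<lambda>i. - q i z) (\<lambda>i. i \<in> {0, 1, 2, 3, 4}) i"
    using ex_is_arg_min_if_finite[of "{0, 1, 2, 3, 4::nat}" "\<lambda>i. - q i z"] by auto
  then have i: "i \<in> {0, 1, 2, 3, 4}" "\<And>j. j \<in> {0, 1, 2, 3, 4} \<Longrightarrow> \<not> - q j z < - q i z"
    unfolding is_arg_min_def by blast+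
  have "q j z \<le> q i z" if "j \<in> {0, 1, 2, 3, 4}" for j
    using i(2)[OF that] by simp
  then have "dominant q i z"
    by (intro dominantI) simp_all
  with i(1) show thesis
    by (rule that)
qed

text \<open>Opposite to the bisector of cone \<open>0\<close> runs the common boundary of cones
  \<open>2\<close> and \<open>3\<close>. A vector to the right of the bisector has its opposite on
  the left of this boundary, in cone \<open>3\<close>. Hence \<open>w\<close> looks for
  \<open>u\<close> in cone \<open>3\<close>.\<close>

lemma dominant_3_minus:
  assumes "dominant q 0 w" "q 4 w \<le> q 1 w"
  shows "dominant q 3 (- w)"
proof (rule dominantI)
  have "q 1 w - q 3 w = \<phi> * (q 0 w - q 4 w)"
    unfolding q_expand using golden_square by algebra
  moreover have "0 \<le> \<phi> * (q 0 w - q 4 w)"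
    using dominantD[OF assms(1), of 4] golden_bounds by simp
  ultimately show "q 1 (- w) \<le> q 3 (- w)"
    by (simp add: q_minus)
  have "q 2 w - q 3 w = (\<phi> - 1) * (q 1 w - q 4 w)"
    unfolding q_expand using golden_square by algebra
  moreover have "0 \<le> (\<phi> - 1) * (q 1 w - q 4 w)"
    using assms(2) golden_bounds by simp
  ultimately show "q 2 (- w) \<le> q 3 (- w)"
    by (simp add: q_minus)
  have "q 4 w - q 3 w = (\<phi> - 1) * (q 0 w - q 2 w)"
    unfolding q_expand using golden_square by algebra
  moreover have "0 \<le> (\<phi> - 1) * (q 0 w - q 2 w)"
    using dominantD[OF assms(1), of 2] golden_bounds by simp
  ultimately show "q 4 (- w) \<le> q 3 (- w)"
    by (simp add: q_minus)
  show "q 0 (- w) \<le> q 3 (- w)"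
    using assms by (simp add: q_minus dominantD)
qed simp

section \<open>Linear certificates for the detours\<close>

text \<open>
  In the next lemmas \<open>u\<close> is the origin, \<open>v\<close> is the point closest to \<open>w\<close> in the cone of
  \<open>w\<close> that contains \<open>u\<close>, and \<open>z\<close> is the point closest to \<open>u\<close> in cone \<open>0\<close>. An edge has
  length at most a fixed multiple of its gauge, so that \<open>\<kappa> * q j v + q 3 (v - w) \<le> \<kappa> * q 0 w\<close> says that
  the walk from \<open>u\<close> through \<open>v\<close> to \<open>w\<close> is short enough. Within one combination of cones
  everything is linear; the multipliers are exact Farkas certificates over \<open>\<rat>(\<surd>5)\<close>.
\<close>

lemma q_3_minus_le:
  assumes "dominant q 0 w"
  shows "q 3 (- w) \<le> \<kappa> * q 0 w"
proof -
  have "\<kappa> * q 0 w - q 3 (- w) = (1 + \<phi>) * (q 0 w - q 2 w) + \<phi> * (q 0 w - q 3 w)"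
    unfolding q_expand kappa_eq using golden_square by algebra
  also have "0 \<le> \<dots>"
    using assms golden_bounds by (intro add_nonneg_nonneg mult_nonneg_nonneg) (auto simp: dominantD)
  finally show ?thesis
    by simp
qed

text \<open>Cones \<open>2\<close> and \<open>3\<close> lie strictly below the horizontal through
  their apex, while \<open>w\<close> is no lower than \<open>z\<close>. With positivity of the
  gauge, this lemma and the next exclude both cones for \<open>w - z \<noteq> 0\<close>.\<close>

lemma w_minus_z_cone_2:
  assumes "dominant q 2 (w - z)" "q 0 z \<le> q 0 w"
  shows "q 2 (w - z) \<le> 0"
proof -
  have "- q 2 (w - z) = (1 + \<phi>) * (q 0 w - q 0 z) + \<phi> * (q 2 (w - z) - q 1 (w - z))"
    unfolding q_expand using golden_square by algebra
  also have "0 \<le> \<dots>"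
    using assms golden_bounds by (intro add_nonneg_nonneg mult_nonneg_nonneg) (auto simp: dominantD)
  finally show ?thesis
    by simp
qed

lemma w_minus_z_cone_3:
  assumes "dominant q 3 (w - z)" "q 0 z \<le> q 0 w"
  shows "q 3 (w - z) \<le> 0"
proof -
  have "- q 3 (w - z) = (1 + \<phi>) * (q 0 w - q 0 z) + \<phi> * (q 3 (w - z) - q 4 (w - z))"
    unfolding q_expand using golden_square by algebra
  also have "0 \<le> \<dots>"
    using assms golden_bounds by (intro add_nonneg_nonneg mult_nonneg_nonneg) (auto simp: dominantD)
  finally show ?thesis
    by simp
qed

text \<open>The vectors opposite to cone \<open>1\<close> are covered by cones \<open>3\<close> and
  \<open>4\<close>, so they meet cone \<open>2\<close> only in the origin.\<close>

lemma z_minus_w_cone_2: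
  assumes "dominant q 1 (w - z)" "dominant q 2 (z - w)"
  shows "q 2 (z - w) \<le> 0"
proof -
  have "- (5 * q 2 (z - w)) = (1 + 3 * \<phi>) * (q 1 (w - z) - q 0 (w - z)) +
      (2 * \<phi> - 1) * (q 2 (z - w) - q 3 (z - w))"
    unfolding q_expand using golden_square by algebra
  also have "0 \<le> \<dots>"
    using assms golden_bounds by (intro add_nonneg_nonneg mult_nonneg_nonneg) (auto simp: dominantD)
  finally show ?thesis
    by simp
qed

text \<open>Along cone \<open>3\<close>, \<open>q 0\<close> drops by at least
  \<open>1 / \<phi> ^ 2\<close> of the gauge, and \<open>\<kappa> / \<phi> ^ 2\<close> exceeds 1:
  the descent pays for the edge.\<close>

lemma detour_v_cone_0:
  assumes "dominant q 3 (v - w)"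
  shows "\<kappa> * q 0 v + q 3 (v - w) \<le> \<kappa> * q 0 w"
proof -
  have "(\<kappa> * q 0 w - (\<kappa> * q 0 v + q 3 (v - w))) =
      \<phi> * (q 3 (v - w) - q 2 (v - w)) +
      (2 + 3 * \<phi>) * (q 3 (v - w) - q 4 (v - w))"
    unfolding q_expand kappa_eq using golden_square by algebra
  also have "0 \<le> \<dots>"
    using assms golden_bounds by (intro add_nonneg_nonneg mult_nonneg_nonneg) (auto simp: dominantD)
  finally show ?thesis
    by simp
qed

text \<open>Cone \<open>3\<close> is symmetric under the reflection that exchanges bisectors
  \<open>0\<close> and \<open>1\<close>, so \<open>q 1\<close> drops along it as \<open>q 0\<close>
  does, starting from \<open>q 1 w \<le> q 0 w\<close>.\<close>

lemma detour_v_cone_1: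
  assumes "dominant q 0 w" "dominant q 3 (v - w)"
  shows "\<kappa> * q 1 v + q 3 (v - w) \<le> \<kappa> * q 0 w"
proof -
  have "(\<kappa> * q 0 w - (\<kappa> * q 1 v + q 3 (v - w))) =
      (q 3 (v - w) - q 0 (v - w)) +
      (2 + 4 * \<phi>) * (q 0 w - q 1 w) +
      (1 + 3 * \<phi>) * (q 3 (v - w) - q 2 (v - w))"
    unfolding q_expand kappa_eq using golden_square by algebra
  also have "0 \<le> \<dots>"
    using assms golden_bounds by (intro add_nonneg_nonneg mult_nonneg_nonneg) (auto simp: dominantD)
  finally show ?thesis
    by simp
qed

lemma detour_v_cone_2:
  assumes "dominant q 0 w" "dominant q 3 (v - w)" "q 3 (v - w) \<le> q 3 (- w)"
  shows "\<kappa> * q 2 v + q 3 (v - w) \<le> \<kappa> * q 0 w"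
proof -
  have "(\<kappa> * q 0 w - (\<kappa> * q 2 v + q 3 (v - w))) =
      (3 + 5 * \<phi>) * (q 0 w - q 1 w) +
      (3 + 4 * \<phi>) * (q 3 (- w) - q 3 (v - w)) +
      (2 + 4 * \<phi>) * (q 3 (v - w) - q 2 (v - w))"
    unfolding q_expand kappa_eq using golden_square by algebra
  also have "0 \<le> \<dots>"
    using assms golden_bounds by (intro add_nonneg_nonneg mult_nonneg_nonneg) (auto simp: dominantD)
  finally show ?thesis
    by simp
qed

text \<open>The second hypothesis puts \<open>w\<close> at least 18\<degree> to the right of the
  bisector. As \<open>z\<close> does not cross the right boundary of cone \<open>0\<close> and is no
  higher than \<open>w\<close>, little room is left for \<open>w - z\<close> in the direction of
  bisector \<open>4\<close>.\<close>

lemma detour_z_cone_4: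
  assumes "dominant q 0 w" "q 0 w \<le> q 3 (- w)" "dominant q 0 z" "q 0 z \<le> q 0 w"
  shows "\<kappa> * q 4 (w - z) + q 0 z \<le> \<kappa> * q 0 w"
proof -
  have "(\<kappa> * q 0 w - (\<kappa> * q 4 (w - z) + q 0 z)) =
      (5 + 7 * \<phi>) * (q 3 (- w) - q 0 w) +
      (2 + 4 * \<phi>) * (q 0 z - q 1 z) +
      (1 + \<phi>) * (q 0 w - q 2 w) +
      (1 + 2 * \<phi>) * (q 0 w - q 0 z)"
    unfolding q_expand kappa_eq using golden_square by algebra
  also have "0 \<le> \<dots>"
    using assms golden_bounds by (intro add_nonneg_nonneg mult_nonneg_nonneg) (auto simp: dominantD)
  finally show ?thesis
    by simp
qed

text \<open>For the case that \<open>z\<close> lies in cone \<open>3\<close> of \<open>w\<close>: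
  there \<open>v\<close> is closest, which gives the last hypothesis and limits how far
  \<open>v\<close> lies to the left.\<close>

lemma detour_v_z_cone_3:
  assumes "dominant q 3 (v - w)" "dominant q 0 z" "dominant q 1 (w - z)" "q 3 (v - w) \<le> q 3 (z - w)"
  shows "\<kappa> * q 4 v + q 3 (v - w) \<le> \<kappa> * q 0 w"
proof -
  have "(\<kappa> * q 0 w - (\<kappa> * q 4 v + q 3 (v - w))) =
      (1 + \<phi>) * (q 1 (w - z) - q 0 (w - z)) +
      (3 + 4 * \<phi>) * (q 3 (z - w) - q 3 (v - w)) +
      (2 + 4 * \<phi>) * (q 0 z - q 4 z) +
      (2 + 4 * \<phi>) * (q 3 (v - w) - q 4 (v - w))"
    unfolding q_expand kappa_eq using golden_square by algebra
  also have "0 \<le> \<dots>"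
    using assms golden_bounds by (intro add_nonneg_nonneg mult_nonneg_nonneg) (auto simp: dominantD)
  finally show ?thesis
    by simp
qed

text \<open>In this and the next two lemmas \<open>v\<close> lies in cone \<open>0\<close>,
  \<open>1\<close> or \<open>2\<close> of \<open>z\<close>. The projection \<open>q 4 v\<close>
  splits into \<open>q 4 z\<close>, which is at most \<open>q 0 z\<close>, and
  \<open>q 4 (v - z)\<close>, which these cones keep small.\<close>

lemma detour_v_vz_cone_0:
  assumes "dominant q 3 (v - w)" "dominant q 0 z" "dominant q 1 (w - z)" "dominant q 0 (v - z)"
  shows "\<kappa> * q 4 v + q 3 (v - w) \<le> \<kappa> * q 0 w"
proof -
  have "(\<kappa> * q 0 w - (\<kappa> * q 4 v + q 3 (v - w))) =
      (q 1 (w - z) - q 3 (w - z)) +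
      (2 + 4 * \<phi>) * (q 0 z - q 4 z) +
      (2 + 3 * \<phi>) * (q 0 (v - z) - q 4 (v - z)) +
      (1 + 3 * \<phi>) * (q 3 (v - w) - q 4 (v - w))"
    unfolding q_expand kappa_eq using golden_square by algebra
  also have "0 \<le> \<dots>"
    using assms golden_bounds by (intro add_nonneg_nonneg mult_nonneg_nonneg) (auto simp: dominantD)
  finally show ?thesis
    by simp
qed

lemma detour_v_vz_cone_1:
  assumes "dominant q 3 (v - w)" "dominant q 0 z" "dominant q 1 (v - z)"
  shows "\<kappa> * q 4 v + q 3 (v - w) \<le> \<kappa> * q 0 w"
proof -
  have "(\<kappa> * q 0 w - (\<kappa> * q 4 v + q 3 (v - w))) =
      \<phi> * (q 3 (v - w) - q 0 (v - w)) +
      (2 + 2 * \<phi>) * (q 1 (v - z) - q 3 (v - z)) +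
      (1 + 2 * \<phi>) * (q 3 (v - w) - q 4 (v - w)) +
      (2 + 4 * \<phi>) * (q 0 z - q 4 z)"
    unfolding q_expand kappa_eq using golden_square by algebra
  also have "0 \<le> \<dots>"
    using assms golden_bounds by (intro add_nonneg_nonneg mult_nonneg_nonneg) (auto simp: dominantD)
  finally show ?thesis
    by simp
qed

lemma detour_v_vz_cone_2:
  assumes "dominant q 3 (v - w)" "dominant q 0 z" "q 0 z \<le> q 0 w" "dominant q 2 (v - z)"
  shows "\<kappa> * q 4 v + q 3 (v - w) \<le> \<kappa> * q 0 w"
proof -
  have "(\<kappa> * q 0 w - (\<kappa> * q 4 v + q 3 (v - w))) =
      \<phi> * (q 3 (v - w) - q 4 (v - w)) +
      (1 + 3 * \<phi>) * (q 0 w - q 0 z) +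
      (2 + 3 * \<phi>) * (q 2 (v - z) - q 3 (v - z)) +
      (2 + 4 * \<phi>) * (q 0 z - q 4 z)"
    unfolding q_expand kappa_eq using golden_square by algebra
  also have "0 \<le> \<dots>"
    using assms golden_bounds by (intro add_nonneg_nonneg mult_nonneg_nonneg) (auto simp: dominantD)
  finally show ?thesis
    by simp
qed

text \<open>Which of the two routes is short enough depends on the position of \<open>z\<close>.
  Instead of a case split, here and in the next lemma, the two slacks are combined with positive
  weights for which the sum has a certificate.\<close>

lemma detour_z_or_both_vz_cone_3:
  assumes "dominant q 0 w" "q 0 w \<le> q 3 (- w)" "q 3 (v - w) \<le> q 3 (- w)" "q 0 z \<le> q 0 w"
  shows "\<kappa> * q 1 (w - z) + q 0 z \<le> \<kappa> * q 0 w \<or>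
    \<kappa> * q 3 (v - z) + q 0 z + q 3 (v - w) \<le> \<kappa> * q 0 w"
proof -
  have "(2 - \<phi>) * (\<kappa> * q 0 w - (\<kappa> * q 1 (w - z) + q 0 z)) +
      (\<phi> - 1) * (\<kappa> * q 0 w - (\<kappa> * q 3 (v - z) + q 0 z + q 3 (v - w))) =
      (q 3 (- w) - q 0 w) +
      (1 + 2 * \<phi>) * (q 0 w - q 0 z) +
      (1 + 3 * \<phi>) * (q 3 (- w) - q 3 (v - w)) +
      (1 + 2 * \<phi>) * (q 0 w - q 1 w)"
    unfolding q_expand kappa_eq using golden_square by algebra
  also have "0 \<le> \<dots>"
    using assms golden_bounds by (intro add_nonneg_nonneg mult_nonneg_nonneg) (auto simp: dominantD)
  finally show ?thesis
    by (rule weighted_sum_nonneg_cases) (use golden_bounds in simp_all)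
qed

lemma detour_z_or_both_vz_cone_4:
  assumes "dominant q 0 w" "dominant q 3 (v - w)" "q 3 (v - w) \<le> q 3 (- w)" "dominant q 0 z"
  shows "\<kappa> * q 1 (w - z) + q 0 z \<le> \<kappa> * q 0 w \<or>
    \<kappa> * q 4 (v - z) + q 0 z + q 3 (v - w) \<le> \<kappa> * q 0 w"
proof -
  have "(2 + \<phi>) * (\<kappa> * q 0 w - (\<kappa> * q 1 (w - z) + q 0 z)) +
      (8 - \<phi>) * (\<kappa> * q 0 w - (\<kappa> * q 4 (v - z) + q 0 z + q 3 (v - w))) =
      (4 + 12 * \<phi>) * (q 0 z - q 1 z) +
      (1 + 8 * \<phi>) * (q 0 w - q 1 w) +
      (20 + 25 * \<phi>) * (q 3 (- w) - q 3 (v - w)) +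
      (12 + 26 * \<phi>) * (q 3 (v - w) - q 4 (v - w))"
    unfolding q_expand kappa_eq using golden_square by algebra
  also have "0 \<le> \<dots>"
    using assms golden_bounds by (intro add_nonneg_nonneg mult_nonneg_nonneg) (auto simp: dominantD)
  finally show ?thesis
    by (rule weighted_sum_nonneg_cases) (use golden_bounds in simp_all)
qed

end

section \<open>The induction step\<close>

text \<open>\<open>conn x y r\<close> stands for a walk of length at most \<open>r\<close>, in units
  in which an edge costs at most its gauge. Keeping \<open>q\<close> and \<open>conn\<close>
  abstract lets one induction step serve all rotations and reflections of the cones.\<close>

locale theta_walks = pentagon_frame q
  for q :: "nat \<Rightarrow> complex \<Rightarrow> real" +
  fixes P :: "complex set" and conn :: "complex \<Rightarrow> complex \<Rightarrow> real \<Rightarrow> bool"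
  assumes conn_mono: "conn x y r \<Longrightarrow> r \<le> s \<Longrightarrow> conn x y s"
    and conn_sym: "conn x y r \<Longrightarrow> conn y x r"
    and conn_trans: "conn x y r \<Longrightarrow> conn y z s \<Longrightarrow> conn x z (r + s)"
    and q_pos: "dominant q i z \<Longrightarrow> z \<noteq> 0 \<Longrightarrow> 0 < q i z"
    and nearest: "x \<in> P \<Longrightarrow> y \<in> P \<Longrightarrow> y \<noteq> x \<Longrightarrow> dominant q i (y - x) \<Longrightarrow>
      \<exists>v\<in>P. v \<noteq> x \<and> dominant q i (v - x) \<and> conn x v (q i (v - x)) \<and>
        (\<forall>t\<in>P. t \<noteq> x \<longrightarrow> dominant q i (t - x) \<longrightarrow> q i (v - x) \<le> q i (t - x))"
begin

lemma walk_step: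
  assumes "u \<in> P" "w \<in> P" "u \<noteq> w"
    and w: "dominant q 0 (w - u)" "q 4 (w - u) \<le> q 1 (w - u)"
    and IH: "\<And>x y i. x \<in> P \<Longrightarrow> y \<in> P \<Longrightarrow> dominant q i (y - x) \<Longrightarrow> q i (y - x) < q 0 (w - u) \<Longrightarrow>
      conn x y (\<kappa> * q i (y - x))"
  shows "conn u w (\<kappa> * q 0 (w - u))"
proof -
  have kappa: "1 < \<kappa>"
    unfolding kappa_eq using golden_bounds by simp
  \<comment> \<open>A detour within the bound contains an edge of positive cost, so its remaining
    leg has a strictly smaller gauge. Thus each detour inequality also justifies its use of the
    induction hypothesis.\<close>
  have shorter: "a < b" if "\<kappa> * a + r \<le> \<kappa> * b" "0 < r" for a b r
  proof -
    have "\<kappa> * a < \<kappa> * b"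
      using that by simp
    then show ?thesis
      using kappa by simp
  qed
  have q0_pos: "0 < q 0 (w - u)"
    using q_pos[OF w(1)] assms(3) by simp
  have u_w: "dominant q 3 (u - w)"
    using dominant_3_minus[OF w] by simp
  show ?thesis
  proof (cases "q 3 (u - w) < q 0 (w - u)")
    case True
    have "conn w u (\<kappa> * q 3 (u - w))"
      using IH[OF assms(2,1) u_w True] .
    then have "conn w u (\<kappa> * q 0 (w - u))"
      by (rule conn_mono) (use True kappa in simp)
    then show ?thesis
      by (rule conn_sym)
  next
    case False
    \<comment> \<open>In terms of angles: \<open>w - u\<close> is at least 18\<degree> to the right
      of the bisector of cone \<open>0\<close>.\<close>
    then have far: "q 0 (w - u) \<le> q 3 (- (w - u))"
      by simp
    obtain v where v: "v \<in> P" "v \<noteq> w" "dominant q 3 (v - w)" "conn w v (q 3 (v - w))"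
      and v_near: "\<And>t. t \<in> P \<Longrightarrow> t \<noteq> w \<Longrightarrow> dominant q 3 (t - w) \<Longrightarrow> q 3 (v - w) \<le> q 3 (t - w)"
      using nearest[OF assms(2,1,3) u_w] by blast
    have v_pos: "0 < q 3 (v - w)"
      using q_pos[OF v(3)] v(2) by simp
    have v_u: "q 3 (v - w) \<le> q 3 (- (w - u))"
      using v_near[OF assms(1,3) u_w] by simp
    have via_v: ?thesis
      if j: "dominant q j (v - u)" and le: "\<kappa> * q j (v - u) + q 3 (v - w) \<le> \<kappa> * q 0 (w - u)" for j
    proof -
      have "conn u v (\<kappa> * q j (v - u))"
        using IH[OF assms(1) v(1) j] shorter[OF le v_pos] .
      then have "conn u w (\<kappa> * q j (v - u) + q 3 (v - w))"
        using conn_sym[OF v(4)] by (rule conn_trans)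
      then show ?thesis
        using le by (rule conn_mono)
    qed
    have vw: "dominant q 3 ((v - u) - (w - u))" "q 3 ((v - u) - (w - u)) = q 3 (v - w)"
      using v(3) by simp_all
    obtain j where j: "j \<in> {0, 1, 2, 3, 4}" "dominant q j (v - u)"
      by (rule dominant_exists)
    consider "v = u" | "v \<noteq> u" "j = 0" | "j = 1" | "j = 2" | "v \<noteq> u" "j = 3" | "j = 4"
      using j(1) by auto
    then show ?thesis
    proof cases
      case 1
      show ?thesis
        using v(4) q_3_minus_le[OF w(1)] unfolding 1 by (auto intro: conn_sym conn_mono)
    next
      case 2
      then show ?thesis
        using via_v[OF j(2)] detour_v_cone_0[OF vw(1)] by simp
    next
      case 3
      then show ?thesis
        using via_v[OF j(2)] detour_v_cone_1[OF w(1) vw(1)] by simp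
    next
      case 4
      then show ?thesis
        using via_v[OF j(2)] detour_v_cone_2[OF w(1) vw(1)] v_u by simp
    next
      case 5
      then have "0 < q 3 (v - u)"
        using q_pos[OF j(2)] by simp
      moreover have "q 3 (v - u) \<le> 0"
        using v_u by (simp add: q_diff q_minus)
      ultimately show ?thesis
        by simp
    next
      \<comment> \<open>The hard case: \<open>v\<close> is to the upper left of \<open>u\<close>,
        and the route through \<open>v\<close> alone can exceed the bound. Now \<open>z\<close>
        enters.\<close>
      case v_cone: 6
      obtain z where z: "z \<in> P" "z \<noteq> u" "dominant q 0 (z - u)" "conn u z (q 0 (z - u))"
        and z_near: "\<And>t. t \<in> P \<Longrightarrow> t \<noteq> u \<Longrightarrow> dominant q 0 (t - u) \<Longrightarrow> q 0 (z - u) \<le> q 0 (t - u)"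
        using nearest[OF assms(1,2) _ w(1)] assms(3) by blast
      have z_pos: "0 < q 0 (z - u)"
        using q_pos[OF z(3)] z(2) by simp
      have z_w: "q 0 (z - u) \<le> q 0 (w - u)"
        using z_near[OF assms(2) _ w(1)] assms(3) by simp
      have via_z: ?thesis
        if j: "dominant q j (w - z)" and le: "\<kappa> * q j (w - z) + q 0 (z - u) \<le> \<kappa> * q 0 (w - u)" for j
      proof -
        have "conn z w (\<kappa> * q j (w - z))"
          using IH[OF z(1) assms(2) j] shorter[OF le z_pos] .
        then have "conn u w (q 0 (z - u) + \<kappa> * q j (w - z))"
          by (rule conn_trans[OF z(4)])
        then show ?thesis
          by (rule conn_mono) (use le in simp)
      qed
      have via_both: ?thesis
        if j: "dominant q j (v - z)"
          and le: "\<kappa> * q j (v - z) + q 0 (z - u) + q 3 (v - w) \<le> \<kappa> * q 0 (w - u)" for j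
      proof -
        have "conn z v (\<kappa> * q j (v - z))"
          using IH[OF z(1) v(1) j] shorter[of _ "q 0 (z - u) + q 3 (v - w)"] le z_pos v_pos by simp
        then have "conn u w (q 0 (z - u) + \<kappa> * q j (v - z) + q 3 (v - w))"
          by (intro conn_trans[OF conn_trans[OF z(4)] conn_sym[OF v(4)]])
        then show ?thesis
          by (rule conn_mono) (use le in simp)
      qed
      have wz: "(w - u) - (z - u) = w - z" and vz: "(v - u) - (z - u) = v - z"
        and zw: "(z - u) - (w - u) = z - w"
        by simp_all
      obtain l where l: "l \<in> {0, 1, 2, 3, 4}" "dominant q l (w - z)"
        by (rule dominant_exists)
      consider "z = w" | "z \<noteq> w" "l = 0" | "z \<noteq> w" "l = 1" | "z \<noteq> w" "l = 2" | "z \<noteq> w" "l = 3" | "l = 4"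
        using l(1) by auto
      then show ?thesis
      proof cases
        case 1
        have "q 0 (w - u) \<le> \<kappa> * q 0 (w - u)"
          using kappa q0_pos by simp
        then show ?thesis
          using z(4) unfolding 1 by (rule conn_mono[rotated])
      next
        case 2
        have "0 \<le> (\<kappa> - 1) * q 0 (z - u)"
          using kappa z_pos by simp
        then have "\<kappa> * q 0 (w - z) + q 0 (z - u) \<le> \<kappa> * q 0 (w - u)"
          by (simp add: q_diff algebra_simps)
        then show ?thesis
          using via_z[OF l(2)] 2(2) by simp
      next
        case 4
        then show ?thesis
          using w_minus_z_cone_2[of "w - u" "z - u"] z_w l(2) q_pos[OF l(2)] by simp
      next
        case 5
        then show ?thesis
          using w_minus_z_cone_3[of "w - u" "z - u"] z_w l(2) q_pos[OF l(2)] by simp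
      next
        case 6
        then show ?thesis
          using via_z[OF l(2)] detour_z_cone_4[OF w(1) far z(3) z_w] unfolding wz by simp
      next
        case z_cone: 3
        have l1: "dominant q 1 ((w - u) - (z - u))"
          using l(2) z_cone(2) by simp
        have v4: "dominant q 4 (v - u)"
          using j(2) v_cone by simp
        obtain k where k: "k \<in> {0, 1, 2, 3, 4}" "dominant q k (z - w)"
          by (rule dominant_exists)
        have k_pos: "0 < q k (z - w)"
          using q_pos[OF k(2)] z_cone(1) by simp
        have "q 0 (z - w) \<le> 0" "q 1 (z - w) \<le> 0"
          using z_w dominantD[OF l1, of 0] by (simp_all add: q_diff)
        moreover have "q 2 (z - w) \<le> 0" if "k = 2"
          using z_minus_w_cone_2[OF l1] k(2) that by simp
        ultimately have "k = 3 \<or> k = 4"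
          using k_pos k(1) by auto
        then show ?thesis
        proof
          assume k3: "k = 3"
          have "q 3 (v - w) \<le> q 3 (z - w)"
            using v_near[OF z(1) z_cone(1)] k(2) k3 by simp
          then show ?thesis
            using via_v[OF v4] detour_v_z_cone_3[OF vw(1) z(3) l1] by simp
        next
          \<comment> \<open>With \<open>z\<close> in cone \<open>4\<close> of \<open>w\<close>, the
            position of \<open>v\<close> relative to \<open>z\<close> decides: cones
            \<open>0\<close>, \<open>1\<close>, \<open>2\<close> allow the route through
            \<open>v\<close>, while cones \<open>3\<close> and \<open>4\<close> leave the choice
            between \<open>z\<close> alone and \<open>z\<close> followed by
            \<open>v\<close>.\<close>
          obtain m where m: "m \<in> {0, 1, 2, 3, 4}" "dominant q m ((v - u) - (z - u))"
            by (rule dominant_exists)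
          consider "m = 0" | "m = 1" | "m = 2" | "m = 3" | "m = 4"
            using m(1) by auto
          then show ?thesis
          proof cases
            case 1
            then show ?thesis
              using via_v[OF v4] detour_v_vz_cone_0[OF vw(1) z(3) l1] m(2) vw(2) by simp
          next
            case 2
            then show ?thesis
              using via_v[OF v4] detour_v_vz_cone_1[OF vw(1) z(3)] m(2) vw(2) by simp
          next
            case 3
            then show ?thesis
              using via_v[OF v4] detour_v_vz_cone_2[OF vw(1) z(3) z_w] m(2) vw(2) by simp
          next
            case 4
            then show ?thesis
              using via_z[of 1] l1 via_both[of 3] m(2)
                detour_z_or_both_vz_cone_3[OF w(1) far, of "v - u" "z - u"] v_u z_w
              unfolding wz vz vw(2) by auto
          next
            case 5
            then show ?thesis
              using via_z[of 1] l1 via_both[of 4] m(2)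
                detour_z_or_both_vz_cone_4[OF w(1) vw(1) _ z(3)] v_u
              unfolding wz vz vw(2) by auto
          qed
        qed
      qed
    qed
  qed
qed

end

section \<open>The cones in the plane\<close>

definition bproj :: "nat \<Rightarrow> complex \<Rightarrow> real" where
  "bproj i z = z \<bullet> bisector_dir i"

section \<open>Trigonometry of the angle 72\<degree>\<close>

lemma cos_theta: "cos theta = (\<phi> - 1) / 2"
proof -
  define c where "c = cos theta"
  \<comment> \<open>Five times the angle is a full turn, so the multiples 2 and 3 have equal
    cosines. This gives a cubic for \<open>c\<close> with the trivial root 1; positivity selects the
    right root of the remaining quadratic.\<close>
  have "cos (3 * theta) = cos (2 * pi - 2 * theta)"
    by (simp add: theta_def)
  also have "\<dots> = cos (2 * theta)"
    by (simp add: cos_diff)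
  finally have "4 * c ^ 3 - 3 * c = 2 * c\<^sup>2 - 1"
    unfolding c_def cos_treble_cos cos_double_cos .
  then have "(c - 1) * (4 * c\<^sup>2 + 2 * c - 1) = 0"
    by algebra
  moreover have "c < 1"
    using cos_monotone_0_pi[of 0 theta] by (simp add: c_def theta_def)
  ultimately have "4 * c\<^sup>2 + 2 * c - 1 = 0"
    by simp
  then have "(2 * c - (\<phi> - 1)) * (2 * c + \<phi>) = 0"
    using golden_square by algebra
  moreover have "0 < c"
    unfolding c_def by (rule cos_gt_zero) (simp_all add: theta_def)
  ultimately show ?thesis
    using golden_bounds by (simp add: c_def)
qed

lemma sin_theta_square: "4 * (sin theta * sin theta) = \<phi> + 2"
proof -
  have "4 * (sin theta * sin theta) + (\<phi> - 1) * (\<phi> - 1) = 4"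
    using sin_cos_squared_add[of theta] unfolding cos_theta by (simp add: power2_eq_square field_simps)
  then show ?thesis
    using golden_square by (simp add: algebra_simps)
qed

lemma sin_theta_pos: "0 < sin theta"
  by (rule sin_gt_zero) (simp_all add: theta_def)

lemma cos_2_theta: "cos (2 * theta) = - \<phi> / 2"
  unfolding cos_double_cos cos_theta using golden_square by (simp add: power2_eq_square field_simps)

lemma sin_2_theta: "sin (2 * theta) = (\<phi> - 1) * sin theta"
  by (simp add: sin_double cos_theta)

lemma cos_3_theta: "cos (3 * theta) = - \<phi> / 2"
  and sin_3_theta: "sin (3 * theta) = - ((\<phi> - 1) * sin theta)"
proof -
  have "cos (3 * theta) = cos (2 * pi - 2 * theta)" "sin (3 * theta) = sin (2 * pi - 2 * theta)"
    by (simp_all add: theta_def)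
  then show "cos (3 * theta) = - \<phi> / 2" "sin (3 * theta) = - ((\<phi> - 1) * sin theta)"
    by (simp_all add: cos_diff sin_diff cos_2_theta sin_2_theta)
qed

lemma bisector_dir_add: "bisector_dir (i + m) = bisector_dir i * cis (- (real m * theta))"
  by (simp add: bisector_dir_def cis_mult algebra_simps)

lemma norm_bisector_dir: "norm (bisector_dir i) = 1"
  by (simp add: bisector_dir_def norm_mult)

lemma bisector_dir_mult_cnj: "bisector_dir i * cnj (bisector_dir i) = 1"
  using complex_norm_square[of "bisector_dir i"] norm_bisector_dir[of i] by simp

lemma ray_dir_add: "ray_dir (i + m) = - (bisector_dir i * cis (- (real m * theta)))"
  by (simp add: bisector_dir_def ray_dir_def cis_mult algebra_simps)

text \<open>Of three consecutive bisectors, the outer two add up to 2 cos 72\<degree> times the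
  middle one.\<close>

lemma bproj_Suc_Suc: "bproj (Suc (Suc i)) z = (\<phi> - 1) * bproj (Suc i) z - bproj i z"
proof -
  have "cis (- theta) + cis theta = of_real (\<phi> - 1)"
    by (simp add: complex_eq_iff cos_theta)
  moreover have "bisector_dir (Suc i) = bisector_dir i * cis (- theta)"
    "bisector_dir (Suc (Suc i)) = bisector_dir (Suc i) * cis (- theta)"
    using bisector_dir_add[of i 1] bisector_dir_add[of "Suc i" 1] by simp_all
  moreover from this(1) have "bisector_dir i = bisector_dir (Suc i) * cis theta"
    by (simp add: mult.assoc cis_mult)
  ultimately have "bisector_dir (Suc (Suc i)) + bisector_dir i = (\<phi> - 1) *\<^sub>R bisector_dir (Suc i)"
    by (metis distrib_left mult.commute scaleR_conv_of_real)
  then have "bisector_dir (Suc (Suc i)) = (\<phi> - 1) *\<^sub>R bisector_dir (Suc i) - bisector_dir i"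
    by (simp add: eq_diff_eq)
  then show ?thesis
    by (simp add: bproj_def inner_diff_right)
qed

interpretation bproj: pentagon_frame bproj
  by unfold_locales (simp_all add: bproj_def inner_diff_left bproj_Suc_Suc[unfolded bproj_def])

lemma bproj_frame: "pentagon_frame (\<lambda>i. bproj (a + i))"
  by unfold_locales (simp_all add: bproj.q_diff bproj_Suc_Suc)

text \<open>Since 4 is -1 modulo 5, the indices \<open>a + 4 * i\<close> run through the cones
  counterclockwise from cone \<open>a\<close>, which is the reflection in its bisector, without
  leaving the naturals.\<close>

lemma bproj_reflected_frame: "pentagon_frame (\<lambda>i. bproj (a + 4 * i))"
proof
  fix i x
  show "bproj (a + 4 * Suc (Suc i)) x = (\<phi> - 1) * bproj (a + 4 * Suc i) x - bproj (a + 4 * i) x"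
    using bproj_Suc_Suc[of "a + 4 * i + 3" x] bproj.q_periodic[of "a + 4 * i" x]
      bproj.q_periodic[of "a + 4 * i + 3" x]
    by (simp add: numeral_eq_Suc)
qed (rule bproj.q_diff)

lemma dominant_bproj_shift:
  "dominant (\<lambda>i. bproj (a + i)) i z \<longleftrightarrow> dominant bproj (a + i) z"
proof
  assume *: "dominant (\<lambda>i. bproj (a + i)) i z"
  show "dominant bproj (a + i) z"
    unfolding dominant_def
  proof
    fix k
    have "bproj (a + (k + 4 * a)) z = bproj k z"
      using bproj.q_periodic_mult[of k a z] by (simp add: algebra_simps)
    then show "bproj k z \<le> bproj (a + i) z"
      using dominantD[OF *, of "k + 4 * a"] by simp
  qed
qed (simp add: dominant_def)

lemma dominant_bproj_reflected:
  "dominant (\<lambda>i. bproj (a + 4 * i)) i z \<longleftrightarrow> dominant bproj (a + 4 * i) z"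
proof
  assume *: "dominant (\<lambda>i. bproj (a + 4 * i)) i z"
  show "dominant bproj (a + 4 * i) z"
    unfolding dominant_def
  proof
    fix k
    \<comment> \<open>As 4 is its own inverse modulo 5, the index \<open>4 * k + a\<close> of the
      reflected frame is cone \<open>k\<close>.\<close>
    have "bproj (a + 4 * (4 * k + a)) z = bproj k z"
      using bproj.q_periodic_mult[of k "3 * k + a" z] by (simp add: algebra_simps)
    then show "bproj k z \<le> bproj (a + 4 * i) z"
      using dominantD[OF *, of "4 * k + a"] by simp
  qed
qed (simp add: dominant_def)

lemma bproj_rotate:
  "bproj (i + m) z = Re (z * cnj (bisector_dir i) * cis (real m * theta))"
  by (simp add: bproj_def bisector_dir_add inner_complex_def cis_cnj algebra_simps)

text \<open>In \<open>\<zeta>\<close> the bisector is the positive real axis. The inequality says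
  \<open>\<bar>Im \<zeta>\<bar> \<le> tan (theta / 2) * Re \<zeta>\<close>, multiplied by
  \<open>2 * sin theta\<close>; it compares with the two neighbouring bisectors and implies the
  comparison with the others.\<close>

lemma dominant_bproj_iff:
  fixes z :: complex and i :: nat
  defines "\<zeta> \<equiv> z * cnj (bisector_dir i)"
  shows "dominant bproj i z \<longleftrightarrow> 2 * (\<bar>Im \<zeta>\<bar> * sin theta) \<le> (3 - \<phi>) * Re \<zeta>"
proof -
  interpret i: pentagon_frame "\<lambda>m. bproj (i + m)"
    by (rule bproj_frame)
  have b0: "bproj (i + 0) z = Re \<zeta>"
    and b1: "2 * bproj (i + 1) z = (\<phi> - 1) * Re \<zeta> - 2 * (Im \<zeta> * sin theta)"
    unfolding bproj_rotate \<zeta>_def[symmetric] by (simp_all add: cos_theta field_simps)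
  have b4: "2 * bproj (i + 4) z = (\<phi> - 1) * Re \<zeta> + 2 * (Im \<zeta> * sin theta)"
    using i.q4[of z] b0 b1 by algebra
  have b2: "2 * bproj (i + 2) z = - \<phi> * Re \<zeta> - 2 * ((\<phi> - 1) * (Im \<zeta> * sin theta))"
    using i.q2[of z] b0 b1 golden_square by algebra
  have b3: "2 * bproj (i + 3) z = - \<phi> * Re \<zeta> + 2 * ((\<phi> - 1) * (Im \<zeta> * sin theta))"
    using i.q3[of z] b0 b1 golden_square by algebra
  have abs: "\<bar>Im \<zeta>\<bar> * sin theta = \<bar>Im \<zeta> * sin theta\<bar>"
    using sin_theta_pos by (simp add: abs_mult)
  show ?thesis
  proof
    assume "dominant bproj i z"
    then have "bproj (i + 1) z \<le> bproj (i + 0) z" "bproj (i + 4) z \<le> bproj (i + 0) z"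
      by (simp_all add: dominantD)
    then show "2 * (\<bar>Im \<zeta>\<bar> * sin theta) \<le> (3 - \<phi>) * Re \<zeta>"
      using b0 b1 b4 unfolding abs by (simp add: algebra_simps abs_le_iff)
  next
    assume *: "2 * (\<bar>Im \<zeta>\<bar> * sin theta) \<le> (3 - \<phi>) * Re \<zeta>"
    then have "0 \<le> (3 - \<phi>) * Re \<zeta>"
      using sin_theta_pos by (smt (verit) abs_ge_zero mult_nonneg_nonneg)
    then have Re: "0 \<le> Re \<zeta>"
      using golden_bounds by (simp add: zero_le_mult_iff)
    have "2 * ((\<phi> - 1) * \<bar>Im \<zeta> * sin theta\<bar>) = (\<phi> - 1) * (2 * \<bar>Im \<zeta> * sin theta\<bar>)"
      by simp
    also have "\<dots> \<le> (\<phi> - 1) * ((3 - \<phi>) * Re \<zeta>)"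
      using * golden_bounds unfolding abs by (intro mult_left_mono) simp_all
    also have "\<dots> = (3 * \<phi> - 4) * Re \<zeta>"
      using golden_square by algebra
    also have "\<dots> \<le> (2 + \<phi>) * Re \<zeta>"
      using Re golden_bounds by (intro mult_right_mono) simp_all
    finally have "2 * \<bar>(\<phi> - 1) * (Im \<zeta> * sin theta)\<bar> \<le> (2 + \<phi>) * Re \<zeta>"
      using golden_bounds by (simp add: abs_mult)
    moreover have "(2 + \<phi>) * Re \<zeta> = 2 * Re \<zeta> + \<phi> * Re \<zeta>"
      by algebra
    ultimately have "bproj (i + 2) z \<le> bproj (i + 0) z" "bproj (i + 3) z \<le> bproj (i + 0) z"
      using b0 b2 b3 by linarith+
    moreover have "bproj (i + 1) z \<le> bproj (i + 0) z" "bproj (i + 4) z \<le> bproj (i + 0) z"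
      using * b0 b1 b4 unfolding abs by (simp_all add: algebra_simps abs_le_iff)
    ultimately have "dominant (\<lambda>m. bproj (i + m)) 0 z"
      by (intro i.dominantI) simp_all
    then show "dominant bproj i z"
      by (simp add: dominant_bproj_shift)
  qed
qed

text \<open>The factor is the reciprocal of \<open>cos 36\<degree>\<close>; it is attained on the boundary of the cone.\<close>

lemma norm_le_bproj:
  assumes "dominant bproj i z"
  shows "norm z \<le> 2 * (\<phi> - 1) * bproj i z"
proof (rule power2_le_imp_le)
  define \<zeta> where "\<zeta> = z * cnj (bisector_dir i)"
  define X Y where "X = Re \<zeta>" and "Y = Im \<zeta>"
  have *: "2 * (\<bar>Y\<bar> * sin theta) \<le> (3 - \<phi>) * X"
    using assms dominant_bproj_iff[of i z] by (simp add: X_def Y_def \<zeta>_def)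
  then have "0 \<le> (3 - \<phi>) * X"
    using sin_theta_pos by (smt (verit) abs_ge_zero mult_nonneg_nonneg)
  then have X: "0 \<le> X"
    using golden_bounds by (simp add: zero_le_mult_iff)
  have bproj: "bproj i z = X"
    using bproj_rotate[of i 0 z] by (simp add: X_def \<zeta>_def)
  then show "0 \<le> 2 * (\<phi> - 1) * bproj i z"
    using X golden_bounds by simp
  have "(2 * (\<bar>Y\<bar> * sin theta))\<^sup>2 \<le> ((3 - \<phi>) * X)\<^sup>2"
    using * sin_theta_pos by (intro power_mono) simp_all
  also have "(2 * (\<bar>Y\<bar> * sin theta))\<^sup>2 = 4 * (sin theta * sin theta) * Y\<^sup>2"
    by (simp add: power_mult_distrib flip: power2_eq_square)
  also have "\<dots> = (\<phi> + 2) * Y\<^sup>2"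
    unfolding sin_theta_square by simp
  also have "((3 - \<phi>) * X)\<^sup>2 = (10 - 5 * \<phi>) * X\<^sup>2"
    using golden_square by algebra
  finally have "(\<phi> + 2) * (X\<^sup>2 + Y\<^sup>2) \<le> (12 - 4 * \<phi>) * X\<^sup>2"
    by (simp add: algebra_simps)
  also have "\<dots> = (\<phi> + 2) * (2 * (\<phi> - 1) * X)\<^sup>2"
    using golden_square by algebra
  finally have "X\<^sup>2 + Y\<^sup>2 \<le> (2 * (\<phi> - 1) * X)\<^sup>2"
    using golden_bounds by simp
  moreover have "(norm z)\<^sup>2 = X\<^sup>2 + Y\<^sup>2"
    unfolding X_def Y_def by (simp flip: cmod_power2) (simp add: \<zeta>_def norm_mult norm_bisector_dir)
  ultimately show "(norm z)\<^sup>2 \<le> (2 * (\<phi> - 1) * bproj i z)\<^sup>2"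
    by (simp add: bproj)
qed

text \<open>In the coordinate \<open>\<zeta>\<close> the two boundary rays have the directions cos
  36\<degree> \<plusminus> i sin 36\<degree>, with \<open>\<phi> / 2\<close> for the cosine and
  \<open>(\<phi> - 1) * sin theta\<close> for the sine. They bound the wedge of
  \<open>dominant_bproj_iff\<close>.\<close>

lemma theta_cone_iff: "v \<in> theta_cone i u \<longleftrightarrow> dominant bproj i (v - u)"
proof -
  define \<zeta> where "\<zeta> = (v - u) * cnj (bisector_dir i)"
  have rays: "ray_dir (i + 2) = bisector_dir i * Complex (\<phi> / 2) ((\<phi> - 1) * sin theta)"
    "ray_dir (i + 3) = bisector_dir i * Complex (\<phi> / 2) (- (\<phi> - 1) * sin theta)"
    unfolding ray_dir_add
    by (simp_all add: complex_eq_iff cos_2_theta sin_2_theta cos_3_theta sin_3_theta)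
      (simp_all add: algebra_simps)
  have split: "v - u = bisector_dir i * \<zeta>"
    using bisector_dir_mult_cnj by (simp add: \<zeta>_def mult.left_commute)
  have nonzero: "bisector_dir i \<noteq> 0"
    using norm_bisector_dir[of i] by auto
  have eq: "v = u + a *\<^sub>R ray_dir (i + 2) + b *\<^sub>R ray_dir (i + 3) \<longleftrightarrow>
      Re \<zeta> = \<phi> / 2 * (a + b) \<and> Im \<zeta> = (\<phi> - 1) * sin theta * (a - b)" for a b
  proof -
    have "v = u + a *\<^sub>R ray_dir (i + 2) + b *\<^sub>R ray_dir (i + 3) \<longleftrightarrow>
        v - u = a *\<^sub>R ray_dir (i + 2) + b *\<^sub>R ray_dir (i + 3)"
      by (auto simp: algebra_simps)
    also have "\<dots> \<longleftrightarrow> bisector_dir i * \<zeta> = bisector_dir i *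
        (a *\<^sub>R Complex (\<phi> / 2) ((\<phi> - 1) * sin theta) + b *\<^sub>R Complex (\<phi> / 2) (- (\<phi> - 1) * sin theta))"
      unfolding split rays by (simp only: mult_scaleR_right distrib_left)
    also have "\<dots> \<longleftrightarrow> \<zeta> = a *\<^sub>R Complex (\<phi> / 2) ((\<phi> - 1) * sin theta) +
        b *\<^sub>R Complex (\<phi> / 2) (- (\<phi> - 1) * sin theta)"
      using nonzero by simp
    also have "\<dots> \<longleftrightarrow> Re \<zeta> = \<phi> / 2 * (a + b) \<and> Im \<zeta> = (\<phi> - 1) * sin theta * (a - b)"
      by (simp add: complex_eq_iff field_simps)
    finally show ?thesis .
  qed
  have pos: "0 < 2 * \<phi> - 1"
    using golden_bounds by simp
  have "(\<exists>a b. 0 \<le> a \<and> 0 \<le> b \<and> Re \<zeta> = \<phi> / 2 * (a + b) \<and> Im \<zeta> = (\<phi> - 1) * sin theta * (a - b)) \<longleftrightarrow>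
    2 * (\<bar>Im \<zeta>\<bar> * sin theta) \<le> (3 - \<phi>) * Re \<zeta>"
  proof (intro iffI; (elim exE conjE)?)
    fix a b :: real
    assume ab: "0 \<le> a" "0 \<le> b" and \<zeta>: "Re \<zeta> = \<phi> / 2 * (a + b)" "Im \<zeta> = (\<phi> - 1) * sin theta * (a - b)"
    have Re: "2 * Re \<zeta> = \<phi> * (a + b)"
      using \<zeta>(1) by simp
    have "2 * (2 * (\<bar>Im \<zeta>\<bar> * sin theta)) = 4 * (sin theta * sin theta) * ((\<phi> - 1) * \<bar>a - b\<bar>)"
      unfolding \<zeta> using sin_theta_pos golden_bounds by (simp add: abs_mult)
    also have "\<dots> = (2 * \<phi> - 1) * \<bar>a - b\<bar>"
      unfolding sin_theta_square using golden_square by algebra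
    also have "\<dots> \<le> (2 * \<phi> - 1) * (a + b)"
      using ab pos by (intro mult_left_mono) auto
    also have "\<dots> = 2 * ((3 - \<phi>) * Re \<zeta>)"
      using Re golden_square by algebra
    finally show "2 * (\<bar>Im \<zeta>\<bar> * sin theta) \<le> (3 - \<phi>) * Re \<zeta>"
      by (simp only: mult_le_cancel_left_pos zero_less_numeral)
  next
    assume *: "2 * (\<bar>Im \<zeta>\<bar> * sin theta) \<le> (3 - \<phi>) * Re \<zeta>"
    \<comment> \<open>The solution of the two linear equations for the ray coefficients; the
      denominator is the square root of 5.\<close>
    define a b where "a = ((3 - \<phi>) * Re \<zeta> + 2 * (Im \<zeta> * sin theta)) / (2 * \<phi> - 1)"
      and "b = ((3 - \<phi>) * Re \<zeta> - 2 * (Im \<zeta> * sin theta)) / (2 * \<phi> - 1)"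
    have "2 * \<bar>Im \<zeta> * sin theta\<bar> \<le> (3 - \<phi>) * Re \<zeta>"
      using * sin_theta_pos by (simp add: abs_mult)
    then have "0 \<le> a" "0 \<le> b"
      using pos by (simp_all add: a_def b_def abs_le_iff)
    moreover have "(2 * \<phi> - 1) * a = (3 - \<phi>) * Re \<zeta> + 2 * (Im \<zeta> * sin theta)"
      "(2 * \<phi> - 1) * b = (3 - \<phi>) * Re \<zeta> - 2 * (Im \<zeta> * sin theta)"
      using pos by (simp_all add: a_def b_def)
    then have "(2 * \<phi> - 1) * (2 * Re \<zeta>) = (2 * \<phi> - 1) * (\<phi> * (a + b))"
      "(2 * \<phi> - 1) * Im \<zeta> = (2 * \<phi> - 1) * ((\<phi> - 1) * sin theta * (a - b))"
      using sin_theta_square golden_square by algebra+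
    then have "Re \<zeta> = \<phi> / 2 * (a + b)" "Im \<zeta> = (\<phi> - 1) * sin theta * (a - b)"
      using pos by simp_all
    ultimately show "\<exists>a b. 0 \<le> a \<and> 0 \<le> b \<and> Re \<zeta> = \<phi> / 2 * (a + b) \<and>
        Im \<zeta> = (\<phi> - 1) * sin theta * (a - b)"
      by blast
  qed
  then show ?thesis
    unfolding dominant_bproj_iff theta_cone_def eq \<zeta>_def[symmetric] mem_Collect_eq by blast
qed

text \<open>The bound is cos 144\<degree>. A bisector lies in its own cone, so
  \<open>dominant_3_minus\<close> names the bisector farthest from it without running through the
  residues modulo 5.\<close>

lemma bproj_bisector_dir_ge: "- \<phi> / 2 \<le> bproj j (bisector_dir i)"
proof -
  interpret i: pentagon_frame "\<lambda>m. bproj (i + m)"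
    by (rule bproj_frame)
  have b: "bproj (i + 0) (bisector_dir i) = 1" "2 * bproj (i + 1) (bisector_dir i) = \<phi> - 1"
    unfolding bproj_rotate bisector_dir_mult_cnj by (simp_all add: cos_theta)
  have "dominant (\<lambda>m. bproj (i + m)) 0 (bisector_dir i)"
    unfolding dominant_bproj_shift using golden_bounds dominant_bproj_iff[of i] by (simp add: bisector_dir_mult_cnj)
  moreover have "2 * bproj (i + 4) (bisector_dir i) = \<phi> - 1"
    using i.q4[of "bisector_dir i"] b by algebra
  ultimately have "dominant (\<lambda>m. bproj (i + m)) 3 (- bisector_dir i)"
    using b(2) by (intro i.dominant_3_minus) simp_all
  then have "bproj j (- bisector_dir i) \<le> bproj (i + 3) (- bisector_dir i)"
    unfolding dominant_bproj_shift by (rule dominantD)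
  moreover have "2 * bproj (i + 3) (bisector_dir i) = - \<phi>"
    using i.q3[of "bisector_dir i"] b golden_square by algebra
  ultimately show ?thesis
    by (simp add: bproj.q_minus)
qed

text \<open>
  Two bisectors make an angle of at most \<open>144\<degree>\<close>, so the smaller of the gauges of \<open>z\<close> and \<open>- z\<close>
  is at most \<open>cos 18\<degree>\<close> times the norm.
\<close>

lemma canonical_size_le:
  assumes "m \<le> bproj i z" "m \<le> bproj j (- z)"
  shows "\<kappa> * (2 * (\<phi> - 1)) * m \<le> sqrt (50 + 22 * sqrt 5) * norm z"
proof -
  have norm_1: "bisector_dir k \<bullet> bisector_dir k = 1" for k
    using norm_bisector_dir[of k] by (simp add: dot_square_norm)
  have "(norm (bisector_dir i - bisector_dir j))\<^sup>2 = 2 - 2 * bproj j (bisector_dir i)"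
    by (simp add: power2_norm_eq_inner inner_diff_left inner_diff_right norm_1 bproj_def inner_commute)
  also have "\<dots> \<le> \<phi> + 2"
    using bproj_bisector_dir_ge[of j i] by simp
  finally have norm: "norm (bisector_dir i - bisector_dir j) \<le> sqrt (\<phi> + 2)"
    by (rule real_le_rsqrt)
  \<comment> \<open>Adding the two hypotheses brings in the difference of two unit vectors, of norm
    at most 2 cos 18\<degree>, the square root of \<open>\<phi> + 2\<close>.\<close>
  have "2 * m \<le> z \<bullet> (bisector_dir i - bisector_dir j)"
    using assms by (simp add: bproj_def inner_diff_right)
  also have "\<dots> \<le> norm z * norm (bisector_dir i - bisector_dir j)"
    by (rule norm_cauchy_schwarz)
  also have "\<dots> \<le> norm z * sqrt (\<phi> + 2)"
    using norm by (intro mult_left_mono) simp_all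
  finally have "\<kappa> * (\<phi> - 1) * (2 * m) \<le> \<kappa> * (\<phi> - 1) * (norm z * sqrt (\<phi> + 2))"
    using golden_bounds by (intro mult_left_mono) (simp_all add: kappa_eq)
  moreover have sqrt_eq: "sqrt (50 + 22 * sqrt 5) = \<kappa> * (\<phi> - 1) * sqrt (\<phi> + 2)"
  proof (rule real_sqrt_unique)
    have "(\<kappa> * (\<phi> - 1) * sqrt (\<phi> + 2))\<^sup>2 = (\<kappa> * (\<phi> - 1))\<^sup>2 * (\<phi> + 2)"
      using golden_bounds by (simp add: power_mult_distrib)
    also have "\<dots> = 28 + 44 * \<phi>"
      unfolding kappa_eq using golden_square by algebra
    also have "\<dots> = 50 + 22 * sqrt 5"
      by (simp add: golden_def)
    finally show "(\<kappa> * (\<phi> - 1) * sqrt (\<phi> + 2))\<^sup>2 = 50 + 22 * sqrt 5" .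
    show "0 \<le> \<kappa> * (\<phi> - 1) * sqrt (\<phi> + 2)"
      using golden_bounds by (simp add: kappa_eq)
  qed
  ultimately show ?thesis
    unfolding sqrt_eq by (simp only: mult_ac)
qed

section \<open>Walks and paths in the graph\<close>

text \<open>Vertices may repeat and the last argument is only an upper bound for the length, so
  concatenation and weakening are immediate; repetitions are removed at the end.\<close>

inductive walk :: "'a::metric_space set \<Rightarrow> 'a set set \<Rightarrow> 'a \<Rightarrow> 'a \<Rightarrow> real \<Rightarrow> bool"
  for V E where
  walk_refl: "u \<in> V \<Longrightarrow> 0 \<le> r \<Longrightarrow> walk V E u u r"
| walk_step: "u \<in> V \<Longrightarrow> {u, v} \<in> E \<Longrightarrow> walk V E v w r \<Longrightarrow> dist u v + r \<le> s \<Longrightarrow> walk V E u w s"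

lemma walk_in: "walk V E u w r \<Longrightarrow> u \<in> V \<and> w \<in> V"
  by (induction rule: walk.induct) auto

lemma walk_mono: "walk V E u w r \<Longrightarrow> r \<le> s \<Longrightarrow> walk V E u w s"
  by (erule walk.cases) (auto intro: walk.intros)

lemma walk_trans: "walk V E u v r \<Longrightarrow> walk V E v w s \<Longrightarrow> walk V E u w (r + s)"
proof (induction rule: walk.induct)
  case (walk_refl u r)
  then show ?case
    by (auto elim: walk_mono)
next
  case (walk_step u v w' r t)
  then show ?case
    using walk.walk_step[of u V v E w "r + s" "t + s"] by simp
qed

lemma walk_edge: "u \<in> V \<Longrightarrow> v \<in> V \<Longrightarrow> {u, v} \<in> E \<Longrightarrow> walk V E u v (dist u v)"
  by (rule walk_step[OF _ _ walk_refl[of v _ 0]]) simp_all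

lemma walk_sym: "walk V E u w r \<Longrightarrow> walk V E w u r"
proof (induction rule: walk.induct)
  case (walk_refl u r)
  then show ?case
    by (rule walk.walk_refl)
next
  case (walk_step u v w r s)
  have "walk V E v u (dist v u)"
    using walk_step walk_in[OF walk_step(3)] by (auto intro: walk_edge simp: insert_commute)
  then show ?case
    using walk_trans[OF walk_step(5)] walk_step(4) walk_mono by (fastforce simp: dist_commute)
qed

lemma path_length_Cons_Cons: "path_length (x # y # xs) = dist x y + path_length (y # xs)"
  by (simp add: path_length_def)

lemma path_length_suffix_le: "zs \<noteq> [] \<Longrightarrow> path_length zs \<le> path_length (ys @ zs)"
proof (induction ys)
  case (Cons y ys)
  then obtain x xs where x: "ys @ zs = x # xs"
    by (cases "ys @ zs") auto
  have "path_length (x # xs) \<le> path_length (y # x # xs)"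
    by (simp add: path_length_Cons_Cons)
  then show ?case
    using Cons by (simp flip: x)
qed simp

lemma walk_imp_path: "walk V E u w r \<Longrightarrow> \<exists>xs. path_between V E u xs w \<and> path_length xs \<le> r"
proof (induction rule: walk.induct)
  case (walk_refl u r)
  then show ?case
    by (intro exI[of _ "[u]"]) (simp add: path_between_def path_length_def)
next
  case (walk_step u v w r s)
  then obtain xs where xs: "path_between V E v xs w" "path_length xs \<le> r"
    by blast
  then obtain xs' where xs': "xs = v # xs'"
    by (cases xs) (auto simp: path_between_def)
  show ?case
  proof (cases "u \<in> set xs")
    case True
    \<comment> \<open>The new vertex is already on the path: the closed part before its occurrence
      is cut off.\<close>
    then obtain ys zs where split: "xs = ys @ u # zs"
      by (auto dest: split_list)
    have "path_between V E u (u # zs) w"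
      using xs(1) by (auto simp: path_between_def split successively_append_iff)
    moreover have "path_length (u # zs) \<le> r"
      using path_length_suffix_le[of "u # zs" ys] xs(2) by (simp add: split)
    ultimately show ?thesis
      using walk_step(4) zero_le_dist[of u v] by (meson add_increasing order_trans)
  next
    case False
    then have "path_between V E u (u # xs) w"
      using xs(1) walk_step(1,2) by (auto simp: path_between_def xs')
    moreover have "path_length (u # xs) \<le> s"
      using xs(2) walk_step(4) by (simp add: xs' path_length_Cons_Cons)
    ultimately show ?thesis
      by blast
  qed
qed

section \<open>Nearest points in a cone\<close>

lemma dist_bisector_proj:
  assumes "dominant bproj i (v - u)"
  shows "dist u (bisector_proj i u v) = bproj i (v - u)"
proof -
  have "0 \<le> 2 * (\<phi> - 1) * bproj i (v - u)"
    using norm_le_bproj[OF assms] norm_ge_zero by (rule order_trans[rotated])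
  then have "0 \<le> bproj i (v - u)"
    using golden_bounds by (simp add: zero_le_mult_iff)
  then show ?thesis
    by (simp add: bisector_proj_def dist_norm norm_bisector_dir bproj_def)
qed

lemma bproj_pos:
  assumes "dominant bproj i z" "z \<noteq> 0"
  shows "0 < bproj i z"
proof -
  have "0 < 2 * (\<phi> - 1) * bproj i z"
    using norm_le_bproj[OF assms(1)] assms(2) by (smt (verit) zero_less_norm_iff)
  then show ?thesis
    using golden_bounds by (simp add: zero_less_mult_iff)
qed

lemma closest_in_cone_exists:
  assumes "finite P" "y \<in> P" "y \<noteq> x" "dominant bproj i (y - x)"
  obtains v where "closest_in_cone P i x v" "v \<in> P" "v \<noteq> x" "dominant bproj i (v - x)"
    "\<And>t. t \<in> P \<Longrightarrow> t \<noteq> x \<Longrightarrow> dominant bproj i (t - x) \<Longrightarrow> bproj i (v - x) \<le> bproj i (t - x)"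
proof -
  let ?S = "{v. v \<in> P - {x} \<and> v \<in> theta_cone i x}"
  have "finite ?S" "?S \<noteq> {}"
    using assms by (auto simp: theta_cone_iff)
  then obtain v where v: "closest_in_cone P i x v"
    using ex_is_arg_min_if_finite[of ?S "\<lambda>v. dist x (bisector_proj i x v)"]
    unfolding closest_in_cone_def by auto
  then have "v \<in> P" "v \<noteq> x" "dominant bproj i (v - x)"
    by (auto simp: closest_in_cone_def is_arg_min_def theta_cone_iff)
  moreover have "bproj i (v - x) \<le> bproj i (t - x)"
    if "t \<in> P" "t \<noteq> x" "dominant bproj i (t - x)" for t
    using v that calculation(3)
    by (auto simp: closest_in_cone_def is_arg_min_def theta_cone_iff not_less dist_bisector_proj[symmetric])
  ultimately show thesis
    using v that by blast
qed

lemma bisector_dir_mod: "bisector_dir (i mod 5) = bisector_dir i"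
proof -
  have "bisector_dir i = bisector_dir (i mod 5) * cis (- (2 * pi * real (i div 5)))"
    using bisector_dir_add[of "i mod 5" "i div 5 * 5"] by (simp add: theta_def algebra_simps)
  then show ?thesis
    using cis_multiple_2pi[of "- real (i div 5)"] by simp
qed

text \<open>Re-indexed frames produce cone numbers of any size, whereas edges come from the numbers
  below 5.\<close>

lemma closest_in_cone_mod: "closest_in_cone P (i mod 5) x v \<longleftrightarrow> closest_in_cone P i x v"
  unfolding closest_in_cone_def theta_cone_iff bisector_proj_def bisector_dir_mod
  by (simp add: dominant_def bproj.q_mod)

section \<open>The bound for a finite point set\<close>

locale theta5 =
  fixes P :: "complex set"
  assumes finite: "finite P"
begin

text \<open>In units in which the projection of an edge onto the bisector of its cone bounds its length.\<close>

definition conn :: "complex \<Rightarrow> complex \<Rightarrow> real \<Rightarrow> bool" where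
  "conn x y r \<longleftrightarrow> walk P (theta5_edges P) x y (2 * (\<phi> - 1) * r)"

lemma conn_mono: "conn x y r \<Longrightarrow> r \<le> s \<Longrightarrow> conn x y s"
  unfolding conn_def using golden_bounds by (elim walk_mono) simp

lemma conn_sym: "conn x y r \<Longrightarrow> conn y x r"
  unfolding conn_def by (rule walk_sym)

lemma conn_trans: "conn x y r \<Longrightarrow> conn y z s \<Longrightarrow> conn x z (r + s)"
  unfolding conn_def distrib_left by (rule walk_trans)

lemma nearest:
  assumes "x \<in> P" "y \<in> P" "y \<noteq> x" "dominant bproj i (y - x)"
  shows "\<exists>v\<in>P. v \<noteq> x \<and> dominant bproj i (v - x) \<and> conn x v (bproj i (v - x)) \<and>
    (\<forall>t\<in>P. t \<noteq> x \<longrightarrow> dominant bproj i (t - x) \<longrightarrow> bproj i (v - x) \<le> bproj i (t - x))"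
proof -
  obtain v where v: "closest_in_cone P i x v" "v \<in> P" "v \<noteq> x" "dominant bproj i (v - x)"
    "\<And>t. t \<in> P \<Longrightarrow> t \<noteq> x \<Longrightarrow> dominant bproj i (t - x) \<Longrightarrow> bproj i (v - x) \<le> bproj i (t - x)"
    using closest_in_cone_exists[OF finite assms(2-4)] by blast
  have "closest_in_cone P (i mod 5) x v" "i mod 5 < 5"
    using v(1) by (simp_all add: closest_in_cone_mod)
  then have "{x, v} \<in> theta5_edges P"
    using assms(1) unfolding theta5_edges_def by blast
  then have "walk P (theta5_edges P) x v (dist x v)"
    using assms(1) v(2) by (intro walk_edge)
  then have "conn x v (bproj i (v - x))"
    unfolding conn_def using norm_le_bproj[OF v(4)]
    by (elim walk_mono) (simp add: dist_norm norm_minus_commute)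
  then show ?thesis
    using v by blast
qed

lemma theta_walks_conn:
  assumes frame: "pentagon_frame (\<lambda>i. bproj (f i))"
    and dominant: "\<And>i z. dominant (\<lambda>i. bproj (f i)) i z \<longleftrightarrow> dominant bproj (f i) z"
  shows "theta_walks (\<lambda>i. bproj (f i)) P conn"
proof (intro theta_walks.intro frame theta_walks_axioms.intro)
  show "conn x y s" if "conn x y r" "r \<le> s" for x y r s
    using that by (rule conn_mono)
  show "conn y x r" if "conn x y r" for x y r
    using that by (rule conn_sym)
  show "conn x z (r + s)" if "conn x y r" "conn y z s" for x y z r s
    using that by (rule conn_trans)
  show "0 < bproj (f i) z" if "dominant (\<lambda>i. bproj (f i)) i z" "z \<noteq> 0" for i z
    using that unfolding dominant by (rule bproj_pos)
  show "\<exists>v\<in>P. v \<noteq> x \<and> dominant (\<lambda>i. bproj (f i)) i (v - x) \<and> conn x v (bproj (f i) (v - x)) \<and>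
      (\<forall>t\<in>P. t \<noteq> x \<longrightarrow> dominant (\<lambda>i. bproj (f i)) i (t - x) \<longrightarrow> bproj (f i) (v - x) \<le> bproj (f i) (t - x))"
    if "x \<in> P" "y \<in> P" "y \<noteq> x" "dominant (\<lambda>i. bproj (f i)) i (y - x)" for x y i
    using that unfolding dominant by (rule nearest)
qed

lemma conn_canonical:
  assumes "u \<in> P" "w \<in> P" "dominant bproj i (w - u)"
  shows "conn u w (\<kappa> * bproj i (w - u))"
proof -
  \<comment> \<open>Gauges are real numbers; counting the ordered pairs of smaller gauge turns them
    into a well-founded measure.\<close>
  define rank where "rank r = card {p \<in> P \<times> P. \<exists>j. dominant bproj j (snd p - fst p) \<and>
      bproj j (snd p - fst p) < r}" for r
  show ?thesis
    using assms
  proof (induction "rank (bproj i (w - u))" arbitrary: u w i rule: less_induct)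
    case less
    have IH: "conn x y (\<kappa> * bproj j (y - x))"
      if "x \<in> P" "y \<in> P" "dominant bproj j (y - x)" "bproj j (y - x) < bproj i (w - u)" for x y j
    proof (rule less(1)[OF _ that(1-3)])
      have "(x, y) \<in> {p \<in> P \<times> P. \<exists>j. dominant bproj j (snd p - fst p) \<and>
          bproj j (snd p - fst p) < bproj i (w - u)}"
        using that by auto
      \<comment> \<open>Cones that tie for the pair give the same gauge, so the pair is not counted
        at its own gauge, though it is at the larger one.\<close>
      moreover have "\<not> bproj k (y - x) < bproj j (y - x)" if "dominant bproj k (y - x)" for k
        using dominantD[OF that, of j] by simp
      ultimately show "rank (bproj j (y - x)) < rank (bproj i (w - u))"
        unfolding rank_def using that(4) finite
        by (intro psubset_card_mono) fastforce+
    qed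
    show ?case
    proof (cases "u = w")
      case True
      then show ?thesis
        using less(2) by (simp add: conn_def bproj_def walk_refl)
    next
      case False
      show ?thesis
      proof (cases "bproj (i + 4) (w - u) \<le> bproj (i + 1) (w - u)")
        case True
        interpret theta_walks "\<lambda>k. bproj (i + k)" P conn
          by (intro theta_walks_conn bproj_frame dominant_bproj_shift)
        show ?thesis
          using walk_step[OF less(2,3) False] less(4) True IH by (simp add: dominant_bproj_shift)
      next
        \<comment> \<open>To the left of the bisector, reflection in it exchanges cones
          \<open>i + 1\<close> and \<open>i + 4\<close>.\<close>
        case not_le: False
        interpret theta_walks "\<lambda>k. bproj (i + 4 * k)" P conn
          by (intro theta_walks_conn bproj_reflected_frame dominant_bproj_reflected)
        have "bproj (i + 4 * 4) (w - u) = bproj (i + 1) (w - u)"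
          using bproj.q_periodic_mult[of "i + 1" 3 "w - u"] by (simp add: add.commute)
        then show ?thesis
          using walk_step[OF less(2,3) False] less(4) not_le IH by (simp add: dominant_bproj_reflected)
      qed
    qed
  qed
qed

lemma short_walk:
  assumes "u \<in> P" "w \<in> P"
  shows "walk P (theta5_edges P) u w (sqrt (50 + 22 * sqrt 5) * dist u w)"
proof -
  obtain i j where i: "dominant bproj i (w - u)" and j: "dominant bproj j (u - w)"
    using bproj.dominant_exists by metis
  define m where "m = min (bproj i (w - u)) (bproj j (u - w))"
  have "conn u w (\<kappa> * m)"
    using conn_canonical[OF assms i] conn_sym[OF conn_canonical[OF assms(2,1) j]]
    by (simp add: m_def min_def)
  moreover have "\<kappa> * (2 * (\<phi> - 1)) * m \<le> sqrt (50 + 22 * sqrt 5) * norm (w - u)"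
    by (rule canonical_size_le[of m i _ j]) (simp_all add: m_def)
  ultimately show ?thesis
    unfolding conn_def
    by (elim walk_mono) (simp add: dist_norm norm_minus_commute mult_ac)
qed

end

theorem theorem3:
  fixes P :: "complex set"
  assumes "finite P" and "general_position P"
  shows "spanning_ratio P (theta5_edges P) \<le> ennreal (sqrt (50 + 22 * sqrt 5)) \<and>
    (\<forall>u\<in>P. \<forall>w\<in>P. u \<noteq> w \<longrightarrow>
       (\<exists>xs. path_between P (theta5_edges P) u xs w \<and>
             path_length xs \<le> sqrt (50 + 22 * sqrt 5) * dist u w))"
proof -
  interpret theta5 P
    by unfold_locales (rule assms(1))
  have path: "\<exists>xs. path_between P (theta5_edges P) u xs w \<and>
      path_length xs \<le> sqrt (50 + 22 * sqrt 5) * dist u w" if "u \<in> P" "w \<in> P" for u w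
    using short_walk[OF that] by (rule walk_imp_path)
  have "graph_dist P (theta5_edges P) u w \<le> ennreal (sqrt (50 + 22 * sqrt 5)) * ennreal (dist u w)"
    if uw: "u \<in> P" "w \<in> P" for u w
  proof -
    obtain xs where xs: "path_between P (theta5_edges P) u xs w"
      "path_length xs \<le> sqrt (50 + 22 * sqrt 5) * dist u w"
      using path[OF uw] by blast
    have "graph_dist P (theta5_edges P) u w \<le> ennreal (path_length xs)"
      unfolding graph_dist_def using xs(1) by (intro INF_lower) simp
    also have "\<dots> \<le> ennreal (sqrt (50 + 22 * sqrt 5) * dist u w)"
      using xs(2) by (rule ennreal_leI)
    finally show ?thesis
      by (simp add: ennreal_mult)
  qed
  then have "spanning_ratio P (theta5_edges P) \<le> ennreal (sqrt (50 + 22 * sqrt 5))"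
    unfolding spanning_ratio_def by (intro Inf_lower) simp
  then show ?thesis
    using path by blast
qed

end
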